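(* Let $p>3$ be a prime. Then $$\sum_{n=0}^{p-1}\big(25(2n+1)^3+3(2n+1)\big)(-1)^n{A'_n}^2\equiv -12p^2+40p^4-\frac{40}3p^5B_{p-3}\pmod{p^6}.$$
   Context: $A'_n=\sum_{k=0}^n\binom nk^2\binom{n+k}k$. $\{B_n\}$ are the Bernoulli numbers given by $B_0=1$ and $\sum_{k=0}^{n-1}\binom nkB_k=0$ for $n\ge 2$. A congruence $\alpha\equiv\beta\pmod{p^m}$ between rational numbers with denominators prime to $p$ means that $(\alpha-\beta)/p^m$ is a rational number with denominator prime to $p$. *)

theory Defs
  imports "HOL-Number_Theory.Number_Theory"
begin

definition apery' :: "nat \<Rightarrow> nat" where
  "apery' n = (\<Sum>k=0..n. (n choose k)^2 * ((n + k) choose k))"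

(* The defining relation (\<Sum>k=0..n-1. (n choose k) * B k) = 0 for n \<ge> 2, solved for its last
   term B (n-1) and reindexed.  The lemmas below recover the relation and show that it
   determines the sequence. *)
fun bernoulli :: "nat \<Rightarrow> rat" where
  "bernoulli n =
     (if n = 0 then 1
      else - (\<Sum>k<n. of_nat (Suc n choose k) * bernoulli k) / of_nat (Suc n))"

declare bernoulli.simps [simp del]

lemma bernoulli_0: "bernoulli 0 = 1"
  by (simp add: bernoulli.simps)

lemma bernoulli_sum:
  assumes "n \<ge> 2"
  shows "(\<Sum>k=0..n-1. of_nat (n choose k) * bernoulli k) = 0"
proof -
  obtain m where m: "n = Suc m" "m > 0"
    using assms by (cases n) auto
  have "(\<Sum>k=0..n-1. of_nat (n choose k) * bernoulli k)
      = (\<Sum>k<m. of_nat (Suc m choose k) * bernoulli k) + of_nat (Suc m) * bernoulli m"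
    using m by (simp add: atLeast0AtMost lessThan_Suc_atMost [symmetric] del: of_nat_Suc)
  also have "of_nat (Suc m) * bernoulli m
      = - (\<Sum>k<m. of_nat (Suc m choose k) * bernoulli k)"
    using m by (subst bernoulli.simps) (simp del: of_nat_Suc)
  finally show ?thesis by simp
qed

lemma bernoulli_unique:
  fixes b :: "nat \<Rightarrow> rat"
  assumes b0: "b 0 = 1"
    and bs: "\<And>n. n \<ge> 2 \<Longrightarrow> (\<Sum>k=0..n-1. of_nat (n choose k) * b k) = 0"
  shows "b m = bernoulli m"
proof (induction m rule: less_induct)
  case (less m)
  show ?case
  proof (cases "m = 0")
    case True
    then show ?thesis by (simp add: b0 bernoulli_0)
  next
    case False
    have split: "(\<Sum>k=0..Suc m - 1. of_nat (Suc m choose k) * f k)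
        = (\<Sum>k<m. of_nat (Suc m choose k) * f k) + of_nat (Suc m) * f m" for f :: "nat \<Rightarrow> rat"
      by (simp add: atLeast0AtMost lessThan_Suc_atMost [symmetric] del: of_nat_Suc)
    have "(\<Sum>k<m. of_nat (Suc m choose k) * b k)
        = (\<Sum>k<m. of_nat (Suc m choose k) * bernoulli k)"
      using less by (intro sum.cong) auto
    moreover have "(\<Sum>k<m. of_nat (Suc m choose k) * b k) + of_nat (Suc m) * b m = 0"
      using bs [of "Suc m"] False split [of b] by (simp del: of_nat_Suc)
    moreover have "(\<Sum>k<m. of_nat (Suc m choose k) * bernoulli k) + of_nat (Suc m) * bernoulli m = 0"
      using bernoulli_sum [of "Suc m"] False split [of bernoulli] by (simp del: of_nat_Suc)
    ultimately have "of_nat (Suc m) * b m = of_nat (Suc m) * bernoulli m"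
      by linarith
    then show ?thesis by (simp del: of_nat_Suc)
  qed
qed

definition p_integral :: "nat \<Rightarrow> rat \<Rightarrow> bool" where
  "p_integral p x \<longleftrightarrow> coprime (snd (quotient_of x)) (int p)"

definition rat_cong :: "rat \<Rightarrow> rat \<Rightarrow> nat \<Rightarrow> nat \<Rightarrow> bool" where
  "rat_cong a b p m \<longleftrightarrow>
     p_integral p a \<and> p_integral p b \<and> p_integral p ((a - b) / of_nat p ^ m)"

end

theory Submission
  imports Defs
begin

text \<open>
Write \<open>A\<^bsub>n\<^esub>\<close> for \<^term>\<open>apery' n\<close>. These numbers satisfy a three-term recurrence, proved by creative
telescoping in \<open>apery'_recurrence\<close>. The recurrence shows that the sum telescopes: by
\<open>sum_apery'_squares_closed_form\<close>, for odd \<open>p\<close> the sum up to \<open>p - 1\<close> equals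
\<open>- 4 p\<^sup>2 a b - (8/5) p\<^sup>4 (a\<^sup>2 - 11 a b - b\<^sup>2)\<close> with \<open>a = A\<^bsub>p\<^esub>\<close> and \<open>b = A\<^bsub>p-1\<^esub>\<close>. So the
theorem is a statement about \<open>a\<close> and \<open>b\<close> modulo \<open>p\<^sup>4\<close>.

Let \<open>T\<close> be the sum of \<open>H\<^bsub>k-1\<^esub> / k\<^sup>2\<close> over \<open>0 < k < p\<close>, where \<open>H\<close> denotes the harmonic numbers. The claim
is that, modulo \<open>p\<^sup>4\<close>,
\<open>a = 3 - (5/3) p\<^sup>3 T\<close> and \<open>b = 1 + (5/3) p\<^sup>3 T\<close>, and that \<open>T\<close> is the Bernoulli number of index
\<open>p - 3\<close> modulo \<open>p\<close>. The latter is \<open>nested_harm_pcong\<close>, an application of Faulhaber's formula and of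
Fermat's theorem. It then follows that \<open>a b = 3 + (10/3) p\<^sup>3 T\<close> modulo \<open>p\<^sup>4\<close>, which gives the terms with \<open>p\<^sup>2\<close>
and \<open>p\<^sup>5\<close>, and that the quadratic form is \<open>- 25\<close> modulo \<open>p\<^sup>3\<close>, which gives the term with \<open>p\<^sup>4\<close>.

For the claim on \<open>a\<close>, the terms \<open>0 < k < p\<close> of the defining sum have a factor \<open>(p choose k)\<^sup>2\<close>, hence
\<open>p\<^sup>2 / k\<^sup>2\<close>, and the remaining factors are products of \<open>1 \<plusminus> p / j\<close>
that need only be expanded to first order. For \<open>b\<close> the defining sum is replaced by
\<open>apery'_alternating_form\<close>, whose terms also contain \<open>p\<^sup>2 / k\<^sup>2\<close>. Besides \<open>T\<close>, the expansions contain the sums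
of \<open>1 / k\<^sup>2\<close> and of \<open>1 / k\<^sup>3\<close> and the binomial coefficient \<open>(2 p) choose p\<close>. The sum of \<open>1 / k\<^sup>3\<close> vanishes
modulo \<open>p\<close>. Evaluating \<open>(2 p) choose p\<close> once as a product and once as a sum of squares
shows that the sum of \<open>1 / k\<^sup>2\<close> is \<open>(2/3) p T\<close> modulo \<open>p\<^sup>2\<close> (\<open>harm2_nested_harm_pcong\<close>).
\<close>

section \<open>The recurrence and a closed form for the sum\<close>

definition apery_term :: "nat \<Rightarrow> nat \<Rightarrow> rat" where
  "apery_term n k = of_nat (n choose k)^2 * of_nat ((n + k) choose k)"

lemma apery'_eq_sum_terms:
  assumes "n \<le> N"
  shows "of_nat (apery' n) = (\<Sum>k\<le>N. apery_term n k)"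
proof -
  have "of_nat (apery' n) = (\<Sum>k\<le>n. apery_term n k)"
    by (simp add: apery'_def apery_term_def atLeast0AtMost)
  also have "\<dots> = (\<Sum>k\<le>N. apery_term n k)"
    using assms by (intro sum.mono_neutral_left) (auto simp: apery_term_def)
  finally show ?thesis .
qed

text \<open>
Creative telescoping: the recurrence operator applied to one summand is a
difference in \<open>k\<close>, with the polynomial multiplier \<open>c\<close> as certificate. Once each
binomial coefficient is a polynomial multiple of
\<open>v = (n choose (k - 1)) / k\<close> and \<open>w = ((n + k - 1) choose (k - 1)) / k\<close>, both
sides are polynomials in \<open>n, k, v, w\<close>. Expressing the summands through these smaller
binomial coefficients avoids any division by \<open>n - k\<close> or \<open>n + 1 - k\<close>, so that the values \<open>k \<ge> n\<close>
are covered as well.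
\<close>

lemma apery_certificate_step:
  assumes "n \<ge> 1" "k \<ge> 1"
  defines "c \<equiv> \<lambda>k::nat. (of_nat k)^2 + 3 * (2 * of_nat n + 1) * of_nat k
             - 11 * (of_nat n)^2 - 9 * of_nat n - (2::rat)"
  shows "(of_nat n + 1)^2 * apery_term (n + 1) k - (11 * (of_nat n)^2 + 11 * of_nat n + 3) * apery_term n k
         - (of_nat n)^2 * apery_term (n - 1) k
         = c k * apery_term n k - c (k - 1) * apery_term n (k - 1)"
proof -
  obtain j where k: "k = Suc j" using assms by (cases k) auto
  obtain m where n: "n = Suc m" using assms by (cases n) auto
  define N K :: rat where "N = of_nat n" and "K = of_nat k"
  have [simp]: "K \<noteq> 0" "N \<noteq> 0" by (auto simp: N_def K_def k n)
  have "N + 1 = of_nat (Suc n)" by (simp add: N_def)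
  then have [simp]: "N + 1 \<noteq> 0" by (metis of_nat_eq_0_iff nat.distinct(1))
  define v :: rat where "v = of_nat (n choose j) / K"
  define w :: rat where "w = of_nat ((n + j) choose j) / K"
  have a1: "of_nat (n choose (k - 1)) = K * v" by (simp add: v_def k)
  have a2: "of_nat ((n + 1) choose k) = (N + 1) * v"
  proof -
    have "Suc j * (Suc n choose Suc j) = Suc n * (n choose j)"
      by (rule Suc_times_binomial)
    then have "of_nat (Suc j) * of_nat (Suc n choose Suc j) = (of_nat (Suc n) * of_nat (n choose j) :: rat)"
      by (metis of_nat_mult)
    then show ?thesis by (simp add: v_def k N_def K_def field_simps)
  qed
  have a3: "of_nat (n choose k) = (N + 1 - K) * v"
  proof -
    have "of_nat (Suc n choose Suc j) = (of_nat (n choose j) + of_nat (n choose Suc j) :: rat)"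
      by simp
    then have "of_nat (n choose k) = (N + 1) * v - K * v"
      using a1 a2 by (simp add: k)
    then show ?thesis by (simp add: algebra_simps)
  qed
  have a4: "N * of_nat ((n - 1) choose k) = (N - K) * of_nat (n choose k)"
  proof -
    have "Suc j * (Suc m choose Suc j) = Suc m * (m choose j)"
      by (rule Suc_times_binomial)
    then have "of_nat (Suc j) * of_nat (Suc m choose Suc j) = (of_nat (Suc m) * of_nat (m choose j) :: rat)"
      by (metis of_nat_mult)
    moreover have "of_nat (Suc m choose Suc j) = (of_nat (m choose j) + of_nat (m choose Suc j) :: rat)"
      by simp
    ultimately have "N * (of_nat (n choose k) - of_nat ((n - 1) choose k)) = K * of_nat (n choose k)"
      unfolding N_def K_def n k by (simp add: algebra_simps)
    then show ?thesis by (simp add: algebra_simps)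
  qed
  have b1: "of_nat ((n + (k - 1)) choose (k - 1)) = K * w" by (simp add: w_def k)
  have b2: "of_nat ((n + k) choose k) = (N + K) * w"
  proof -
    have "Suc j * (Suc (n + j) choose Suc j) = Suc (n + j) * ((n + j) choose j)"
      by (rule Suc_times_binomial)
    then have "of_nat (Suc j) * of_nat (Suc (n + j) choose Suc j) = (of_nat (Suc (n + j)) * of_nat ((n + j) choose j) :: rat)"
      by (metis of_nat_mult)
    then show ?thesis by (simp add: w_def k N_def K_def field_simps)
  qed
  have b3: "of_nat ((n - 1 + k) choose k) = N * w"
  proof -
    have "of_nat (Suc (n + j) choose Suc j) = (of_nat ((n + j) choose j) + of_nat ((n + j) choose Suc j) :: rat)"
      by simp
    then have "of_nat ((n + j) choose Suc j) = (N + K) * w - K * w"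
      using b1 b2 by (simp add: k)
    then show ?thesis by (simp add: k n algebra_simps)
  qed
  have b4: "(N + 1) * of_nat ((n + 1 + k) choose k) = (N + K + 1) * ((N + K) * w)"
  proof -
    have "Suc n * (Suc (n + k) choose Suc n) = Suc (n + k) * ((n + k) choose n)"
      by (rule Suc_times_binomial)
    moreover have "Suc (n + k) choose Suc n = (n + 1 + k) choose k"
      by (subst binomial_symmetric) auto
    moreover have "(n + k) choose n = (n + k) choose k"
      by (subst binomial_symmetric) auto
    ultimately have "of_nat (Suc n) * of_nat ((n + 1 + k) choose k)
       = (of_nat (Suc (n + k)) * of_nat ((n + k) choose k) :: rat)"
      by (metis of_nat_mult)
    then show ?thesis using b2 by (simp add: N_def K_def algebra_simps)
  qed
  \<comment> \<open>The coefficients of the recurrence absorb the denominators left in \<open>a4\<close> and \<open>b4\<close>.\<close>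
  have t1: "(N + 1)^2 * apery_term (n + 1) k = (N + 1)^3 * v^2 * ((N + K + 1) * ((N + K) * w))"
    unfolding b4[symmetric] apery_term_def a2 by (simp add: power2_eq_square power3_eq_cube)
  have t2: "apery_term n k = ((N + 1 - K) * v)^2 * ((N + K) * w)"
    unfolding apery_term_def a3 b2 ..
  have "N^2 * apery_term (n - 1) k = (N * of_nat ((n - 1) choose k))^2 * (N * w)"
    unfolding apery_term_def b3 by (simp add: power_mult_distrib)
  then have t3: "N^2 * apery_term (n - 1) k = ((N - K) * ((N + 1 - K) * v))^2 * (N * w)"
    unfolding a4 a3 .
  have t4: "apery_term n (k - 1) = (K * v)^2 * (K * w)"
    unfolding apery_term_def a1 b1 ..
  have km: "of_nat (k - 1) = K - 1" by (simp add: k K_def)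
  show ?thesis
    unfolding c_def km N_def[symmetric] K_def[symmetric] t1 t2 t3 t4
    by (simp add: algebra_simps power2_eq_square power3_eq_cube)
qed

lemma apery'_recurrence:
  assumes "n \<ge> 1"
  shows "(of_nat n + 1)^2 * of_nat (apery' (n + 1))
       = (11 * (of_nat n)^2 + 11 * of_nat n + 3) * of_nat (apery' n)
         + (of_nat n)^2 * (of_nat (apery' (n - 1)) :: rat)"
proof -
  define c where "c = (\<lambda>k::nat. (of_nat k)^2 + 3 * (2 * of_nat n + 1) * of_nat k
             - 11 * (of_nat n)^2 - 9 * of_nat n - (2::rat))"
  define d where "d = (\<lambda>k. (of_nat n + 1)^2 * apery_term (n + 1) k
         - (11 * (of_nat n)^2 + 11 * of_nat n + 3) * apery_term n k
         - (of_nat n)^2 * apery_term (n - 1) k)"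
  have "(\<Sum>k\<le>K. d k) = c K * apery_term n K" for K
  proof (induction K)
    case 0
    then show ?case by (simp add: d_def c_def apery_term_def power2_eq_square algebra_simps)
  next
    case (Suc K)
    have "d (Suc K) = c (Suc K) * apery_term n (Suc K) - c K * apery_term n K"
      using apery_certificate_step[OF assms, of "Suc K"] by (simp add: d_def c_def)
    then show ?case using Suc by simp
  qed
  then have "(\<Sum>k\<le>n+1. d k) = c (n+1) * apery_term n (n+1)" .
  \<comment> \<open>The certificate vanishes above the support, since \<open>n choose (n + 1) = 0\<close>.\<close>
  then have "(\<Sum>k\<le>n+1. d k) = 0"
    by (simp add: apery_term_def del: sum.atMost_Suc)
  then have "(of_nat n + 1)^2 * (\<Sum>k\<le>n+1. apery_term (n + 1) k)
     - (11 * (of_nat n)^2 + 11 * of_nat n + 3) * (\<Sum>k\<le>n+1. apery_term n k)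
     - (of_nat n)^2 * (\<Sum>k\<le>n+1. apery_term (n - 1) k) = 0"
    unfolding d_def by (simp only: sum_subtractf sum_distrib_left)
  moreover have "(\<Sum>k\<le>n+1. apery_term r k) = of_nat (apery' r)" if "r \<le> n + 1" for r
    using apery'_eq_sum_terms[OF that] by simp
  ultimately show ?thesis by simp
qed

lemma apery'_0: "apery' 0 = 1" and apery'_1: "apery' 1 = 3"
  by (simp_all add: apery'_def)

text \<open>
The multiplier in the sum is chosen such that the sum telescopes. The right-hand side
is a quadratic form in two consecutive values; its coefficients were obtained by solving a
linear system for undetermined coefficients, and the induction step is the recurrence
for \<open>(N + 1)\<^sup>2 A'\<^bsub>N+1\<^esub>\<close> substituted into it.
\<close>

lemma sum_apery'_squares_closed_form:
  assumes "N \<ge> 1"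
  shows "(\<Sum>n<N. (25 * (2 * of_nat n + 1)^3 + 3 * (2 * of_nat n + 1)) * (-1)^n * (of_nat (apery' n))^2)
       = (-1)^N * (4 * of_nat N ^ 2 * (of_nat (apery' N) * of_nat (apery' (N - 1)))
           + 8/5 * of_nat N ^ 4 * (of_nat (apery' N) ^ 2
               - 11 * of_nat (apery' N) * of_nat (apery' (N - 1)) - of_nat (apery' (N - 1)) ^ 2) :: rat)"
  using assms
proof (induction N rule: nat_induct_at_least)
  case base
  then show ?case using apery'_1 by (simp add: apery'_0)
next
  case (Suc N)
  define z x y M :: rat where "z = of_nat (apery' (Suc N))" and "x = of_nat (apery' N)"
    and "y = of_nat (apery' (N - 1))" and "M = of_nat N"
  have rec: "(M + 1)^2 * z = (11 * M^2 + 11 * M + 3) * x + M^2 * y"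
    using apery'_recurrence[OF Suc.hyps] by (simp add: z_def x_def y_def M_def)
  \<comment> \<open>Grouped so that \<open>z\<close> only occurs in \<open>(M + 1)\<^sup>2 z\<close>, which the recurrence eliminates.\<close>
  have "4 * M^2 * (x * y) + 8/5 * M^4 * (x^2 - 11 * x * y - y^2)
      + (25 * (2 * M + 1)^3 + 3 * (2 * M + 1)) * x^2
      = - (4 * ((M + 1)^2 * z) * x + 8/5 * (((M + 1)^2 * z)^2 - 11 * (M + 1)^2 * ((M + 1)^2 * z) * x - (M + 1)^4 * x^2))"
    unfolding rec by (simp add: field_simps power2_eq_square power3_eq_cube power4_eq_xxxx)
  also have "\<dots> = - (4 * (M + 1)^2 * (z * x) + 8/5 * (M + 1)^4 * (z^2 - 11 * z * x - x^2))"
    by (simp add: field_simps power2_eq_square power4_eq_xxxx)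
  finally have key: "4 * M^2 * (x * y) + 8/5 * M^4 * (x^2 - 11 * x * y - y^2)
      + (25 * (2 * M + 1)^3 + 3 * (2 * M + 1)) * x^2 = \<dots>" .
  have "(\<Sum>n<Suc N. (25 * (2 * of_nat n + 1)^3 + 3 * (2 * of_nat n + 1)) * (-1)^n * (of_nat (apery' n))^2)
     = (-1)^N * (4 * M^2 * (x * y) + 8/5 * M^4 * (x^2 - 11 * x * y - y^2))
      + (25 * (2 * M + 1)^3 + 3 * (2 * M + 1)) * (-1)^N * x^2"
    using Suc.IH by (simp add: z_def x_def y_def M_def)
  also have "\<dots> = (-1)^N * (4 * M^2 * (x * y) + 8/5 * M^4 * (x^2 - 11 * x * y - y^2)
      + (25 * (2 * M + 1)^3 + 3 * (2 * M + 1)) * x^2)"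
    by (simp only: distrib_left mult.left_commute mult_ac)
  also have "\<dots> = (-1)^Suc N * (4 * (M + 1)^2 * (z * x) + 8/5 * (M + 1)^4 * (z^2 - 11 * z * x - x^2))"
    unfolding key power_Suc by (simp only: mult_minus_left mult_minus_right mult_1)
  finally show ?case
    by (simp add: z_def x_def M_def add.commute)
qed

section \<open>A second binomial sum for the same numbers\<close>

text \<open>
Up to sign, the left-hand side is the \<open>n\<close>-th finite difference at \<open>m\<close> of
\<open>x \<mapsto> x choose (n + j)\<close>, and each difference lowers the bottom index by one.
\<close>

lemma alternating_binomial_difference:
  "(\<Sum>k\<le>n. (-1)^k * of_nat (n choose k) * of_nat ((m + k) choose (n + j)))
     = (-1)^n * (of_nat (m choose j) :: rat)"
proof (induction n arbitrary: m j)
  case 0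
  then show ?case by simp
next
  case (Suc n)
  define f :: "nat \<Rightarrow> rat" where "f k = of_nat ((m + k) choose (Suc n + j))" for k
  have step: "f (Suc k) - f k = of_nat ((m + k) choose (n + j))" for k
    by (simp add: f_def)
  have "(\<Sum>k\<le>Suc n. (-1)^k * of_nat (Suc n choose k) * f k)
      = f 0 + (\<Sum>k\<le>n. (-1)^Suc k * of_nat (Suc n choose Suc k) * f (Suc k))"
    by (subst sum.atMost_Suc_shift) simp
  also have "\<dots> = f 0 + (\<Sum>k\<le>n. (-1)^Suc k * of_nat (n choose k) * f (Suc k))
       + (\<Sum>k\<le>n. (-1)^Suc k * of_nat (n choose Suc k) * f (Suc k))"
    by (simp add: algebra_simps sum_negf sum_subtractf)
  also have "f 0 + (\<Sum>k\<le>n. (-1)^Suc k * of_nat (n choose k) * f (Suc k))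
       + (\<Sum>k\<le>n. (-1)^Suc k * of_nat (n choose Suc k) * f (Suc k))
       = (\<Sum>k\<le>n. (-1)^Suc k * of_nat (n choose k) * f (Suc k))
       + (\<Sum>k\<le>Suc n. (-1)^k * of_nat (n choose k) * f k)"
    by (simp add: sum.atMost_Suc_shift[of _ n] del: sum.atMost_Suc)
  also have "\<dots> = - (\<Sum>k\<le>n. (-1)^k * of_nat (n choose k) * (f (Suc k) - f k))"
    by (simp add: algebra_simps sum_subtractf sum_negf)
  also have "\<dots> = (-1)^Suc n * of_nat (m choose j)"
    unfolding step Suc.IH by simp
  finally show ?case by (simp add: f_def)
qed

text \<open>
At \<open>n = p - 1\<close> the defining sum contains \<open>p\<close> to the first power in each term with \<open>k \<ge> 1\<close>, so these
would have to be expanded to second order modulo \<open>p\<^sup>4\<close>. Here \<open>(n + k) choose k\<close> is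
squared instead, each term with \<open>k \<ge> 1\<close> is divisible by \<open>p\<^sup>2\<close>, and first order is enough. The
identity follows by expanding one of the two factors by Vandermonde and
taking \<open>n\<close>-th differences.
\<close>

lemma apery'_alternating_form:
  "of_nat (apery' n) = (-1)^n * (\<Sum>k\<le>n. (-1)^k * of_nat (n choose k) * (of_nat ((n + k) choose k))^2 :: rat)"
proof -
  have expand: "(of_nat ((n + k) choose k))^2
      = (\<Sum>j\<le>n. of_nat (n choose j) * of_nat ((n + j) choose j) * (of_nat ((n + k) choose (n + j)) :: rat))" for k
  proof -
    have regroup: "(k choose j) * ((n + k) choose k) = ((n + j) choose j) * ((n + k) choose (n + j))" for j
    proof (cases "j \<le> k")
      case True
      have "((n + k) choose k) * (k choose j) = ((n + k) choose j) * ((n + k - j) choose (k - j))"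
        using True by (intro choose_mult) auto
      moreover have "((n + k) choose (n + j)) * ((n + j) choose j) = ((n + k) choose j) * ((n + k - j) choose (n + j - j))"
        using True by (intro choose_mult) auto
      moreover have "(n + k - j) choose (k - j) = (n + k - j) choose (n + j - j)"
        using True by (subst binomial_symmetric) auto
      ultimately show ?thesis by (simp add: mult.commute)
    next
      case False
      then show ?thesis by (simp add: binomial_eq_0)
    qed
    have "(n + k) choose k = (\<Sum>j\<le>k. (n choose j) * (k choose (k - j)))"
      by (rule vandermonde[symmetric])
    also have "\<dots> = (\<Sum>j\<le>k. (n choose j) * (k choose j))"
      by (intro sum.cong refl) (auto simp: binomial_symmetric[symmetric])
    also have "\<dots> = (\<Sum>j\<le>k + n. (n choose j) * (k choose j))"
      by (intro sum.mono_neutral_left) auto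
    also have "\<dots> = (\<Sum>j\<le>n. (n choose j) * (k choose j))"
      by (intro sum.mono_neutral_right) auto
    finally have "((n + k) choose k)^2 = (\<Sum>j\<le>n. (n choose j) * ((k choose j) * ((n + k) choose k)))"
      by (simp add: power2_eq_square sum_distrib_right mult.assoc)
    also have "\<dots> = (\<Sum>j\<le>n. (n choose j) * ((n + j) choose j) * ((n + k) choose (n + j)))"
      by (simp only: regroup mult.assoc)
    finally show ?thesis
      by (simp only: of_nat_mult[symmetric] of_nat_power[symmetric] of_nat_sum[symmetric])
  qed
  have "(\<Sum>k\<le>n. (-1)^k * of_nat (n choose k) * (of_nat ((n + k) choose k))^2 :: rat)
     = (\<Sum>k\<le>n. \<Sum>j\<le>n. of_nat (n choose j) * of_nat ((n + j) choose j)
          * ((-1)^k * of_nat (n choose k) * of_nat ((n + k) choose (n + j))))"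
    unfolding expand sum_distrib_left by (simp add: mult_ac)
  also have "\<dots> = (\<Sum>j\<le>n. of_nat (n choose j) * of_nat ((n + j) choose j)
          * (\<Sum>k\<le>n. (-1)^k * of_nat (n choose k) * of_nat ((n + k) choose (n + j))))"
    by (subst sum.swap) (simp add: sum_distrib_left)
  also have "\<dots> = (-1)^n * (\<Sum>j\<le>n. apery_term n j)"
    unfolding alternating_binomial_difference
    by (simp add: apery_term_def sum_distrib_left power2_eq_square mult_ac)
  finally show ?thesis
    by (simp add: apery'_eq_sum_terms[of n n])
qed

section \<open>Bernoulli numbers and power sums\<close>

lemma bernoulli_recurrence:
  "(\<Sum>i\<le>m. of_nat (Suc m choose i) * bernoulli i) = (if m = 0 then 1 else 0)"
  using bernoulli_sum[of "Suc m"] by (auto simp: bernoulli_0 atLeast0AtMost)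

text \<open>
Faulhaber's formula, cleared of denominators. The difference of the right-hand side
between \<open>n\<close> and \<open>n + 1\<close> is expanded in powers of \<open>n\<close>; the coefficient of \<open>n ^ l\<close> is a multiple of the left-hand side
of \<open>bernoulli_recurrence\<close> for \<open>m - l\<close>, hence zero unless \<open>l = m\<close>.
\<close>

lemma faulhaber:
  "of_nat (Suc m) * (\<Sum>j<n. of_nat j ^ m)
     = (\<Sum>i\<le>m. of_nat (Suc m choose i) * bernoulli i * of_nat n ^ (Suc m - i))"
proof (induction n)
  case 0
  show ?case by (simp add: Suc_diff_le)
next
  case (Suc n)
  define x :: rat where "x = of_nat n"
  let ?S = "\<lambda>y::rat. \<Sum>i\<le>m. of_nat (Suc m choose i) * bernoulli i * y ^ (Suc m - i)"
  have binom: "(x + 1)^(Suc r) - x^(Suc r) = (\<Sum>l\<le>r. of_nat (Suc r choose l) * x^l)" for r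
    using binomial_ring[of x 1 "Suc r"] by simp
  have swap: "(Suc m choose i) * ((Suc m - i) choose l) = (Suc m choose l) * ((Suc m - l) choose i)"
    if "i + l \<le> m" for i l
  proof -
    have "(Suc m choose (i + l)) * ((i + l) choose i) = (Suc m choose i) * ((Suc m - i) choose (i + l - i))"
      using that by (intro choose_mult) auto
    moreover have "(Suc m choose (i + l)) * ((i + l) choose l) = (Suc m choose l) * ((Suc m - l) choose (i + l - l))"
      using that by (intro choose_mult) auto
    moreover have "(i + l) choose i = (i + l) choose l"
      by (subst binomial_symmetric) auto
    ultimately show ?thesis by simp
  qed
  have "?S (x + 1) - ?S x
      = (\<Sum>i\<le>m. of_nat (Suc m choose i) * bernoulli i * ((x + 1) ^ (Suc m - i) - x ^ (Suc m - i)))"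
    by (simp only: sum_subtractf[symmetric] right_diff_distrib)
  also have "\<dots> = (\<Sum>i\<le>m. \<Sum>l\<le>m - i. of_nat ((Suc m choose i) * ((Suc m - i) choose l)) * bernoulli i * x^l)"
  proof (intro sum.cong refl)
    fix i assume "i \<in> {..m}"
    then have *: "Suc m - i = Suc (m - i)" by auto
    show "of_nat (Suc m choose i) * bernoulli i * ((x + 1) ^ (Suc m - i) - x ^ (Suc m - i))
      = (\<Sum>l\<le>m - i. of_nat ((Suc m choose i) * ((Suc m - i) choose l)) * bernoulli i * x^l)"
      unfolding * binom by (simp add: sum_distrib_left mult_ac del: binomial_Suc_Suc)
  qed
  also have "\<dots> = (\<Sum>i\<le>m. \<Sum>l\<le>m - i. of_nat (Suc m choose l) * x^l * (of_nat ((Suc m - l) choose i) * bernoulli i))"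
    by (intro sum.cong refl) (subst swap, auto simp: mult_ac)
  also have "\<dots> = (\<Sum>l\<le>m. \<Sum>i\<le>m - l. of_nat (Suc m choose l) * x^l * (of_nat ((Suc m - l) choose i) * bernoulli i))"
    by (simp add: sum.Sigma) (rule sum.reindex_bij_witness[of _ prod.swap prod.swap], auto)
  also have "\<dots> = (\<Sum>l\<le>m. of_nat (Suc m choose l) * x^l * (if m - l = 0 then 1 else 0))"
  proof (intro sum.cong refl)
    fix l assume "l \<in> {..m}"
    then have *: "Suc m - l = Suc (m - l)" by auto
    show "(\<Sum>i\<le>m - l. of_nat (Suc m choose l) * x^l * (of_nat ((Suc m - l) choose i) * bernoulli i))
      = of_nat (Suc m choose l) * x^l * (if m - l = 0 then 1 else 0)"
      unfolding * sum_distrib_left[symmetric] bernoulli_recurrence ..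
  qed
  also have "\<dots> = (\<Sum>l\<in>{m}. of_nat (Suc m choose l) * x^l)"
    by (intro sum.mono_neutral_cong_right) auto
  finally have "?S (x + 1) = ?S x + of_nat (Suc m) * x^m"
    by (simp add: algebra_simps)
  moreover have "of_nat (Suc n) = x + 1" by (simp add: x_def)
  ultimately show ?case
    using Suc by (simp only: sum.lessThan_Suc distrib_left x_def)
qed

section \<open>The ring of $p$-integral rationals\<close>

locale p_adic =
  fixes p :: nat
  assumes prime_p: "prime p"
begin

abbreviation pint :: "rat \<Rightarrow> bool" where "pint \<equiv> p_integral p"

abbreviation P :: rat where "P \<equiv> of_nat p"

lemma p_nonzero [simp]: "p \<noteq> 0"
  using prime_p by auto

lemma p_not_unit: "\<not> int p dvd 1"
  using prime_gt_1_nat[OF prime_p] by (simp add: zdvd1_eq)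

text \<open>
The form in which closure under the ring operations is visible: the fraction
need not be in lowest terms.
\<close>

lemma pint_iff: "pint x \<longleftrightarrow> (\<exists>a b. \<not> int p dvd b \<and> x = of_int a / of_int b)"
proof
  assume "pint x"
  then have "coprime (snd (quotient_of x)) (int p)" by (simp only: p_integral_def)
  then have "\<not> int p dvd snd (quotient_of x)"
    using p_not_unit coprime_common_divisor[of _ "int p" "int p"] by auto
  moreover have "x = of_int (fst (quotient_of x)) / of_int (snd (quotient_of x))"
    by (rule quotient_of_div) simp
  ultimately show "\<exists>a b. \<not> int p dvd b \<and> x = of_int a / of_int b" by (intro exI conjI)
next
  assume "\<exists>a b. \<not> int p dvd b \<and> x = of_int a / of_int b"
  then obtain a b where ab: "\<not> int p dvd b" "x = of_int a / of_int b" by blast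
  obtain c d where cd: "quotient_of x = (c, d)" by fastforce
  have "b \<noteq> 0" using ab by auto
  moreover have "d > 0" "coprime c d" "x = of_int c / of_int d"
    using cd quotient_of_denom_pos quotient_of_coprime quotient_of_div by auto
  ultimately have "of_int (c * b) = (of_int (a * d) :: rat)"
    using ab by (simp add: field_simps)
  then have "c * b = a * d" by (simp only: of_int_eq_iff)
  then have "d dvd c * b" by simp
  then have "d dvd b"
    using \<open>coprime c d\<close> by (simp add: coprime_commute coprime_dvd_mult_right_iff)
  then have "\<not> int p dvd d" using ab by (meson dvd_trans)
  then have "coprime (int p) d" using prime_p by (simp add: prime_imp_coprime)
  then have "coprime d (int p)" by (simp only: coprime_commute)
  then show "pint x" by (simp only: p_integral_def cd snd_conv)
qed

lemma pint_of_int [simp]: "pint (of_int a)"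
  unfolding pint_iff using p_not_unit by (intro exI[of _ a] exI[of _ 1]) simp

lemma pint_of_nat [simp]: "pint (of_nat a)"
  using pint_of_int[of "int a"] by simp

lemma pint_0 [simp]: "pint 0" and pint_1 [simp]: "pint 1"
  using pint_of_int[of 0] pint_of_int[of 1] by simp_all

lemma pint_numeral [simp]: "pint (numeral a)"
  using pint_of_int[of "numeral a"] by simp

lemma pint_mult [simp]:
  assumes "pint x" "pint y" shows "pint (x * y)"
proof -
  from assms obtain a b c d where "\<not> int p dvd b" "x = of_int a / of_int b"
    "\<not> int p dvd d" "y = of_int c / of_int d" by (auto simp: pint_iff)
  then show ?thesis unfolding pint_iff
    using prime_p by (intro exI[of _ "a * c"] exI[of _ "b * d"]) (auto simp: prime_dvd_mult_iff)
qed

lemma pint_add [simp]: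
  assumes "pint x" "pint y" shows "pint (x + y)"
proof -
  from assms obtain a b c d where *: "\<not> int p dvd b" "x = of_int a / of_int b"
    "\<not> int p dvd d" "y = of_int c / of_int d" by (auto simp: pint_iff)
  moreover have "b \<noteq> 0" "d \<noteq> 0" using * by auto
  ultimately show ?thesis unfolding pint_iff
    using prime_p by (intro exI[of _ "a * d + c * b"] exI[of _ "b * d"])
      (auto simp: prime_dvd_mult_iff field_simps)
qed

lemma pint_minus [simp]: "pint x \<Longrightarrow> pint (- x)"
  using pint_mult[OF pint_of_int[of "-1"], of x] by simp

lemma pint_diff [simp]: "pint x \<Longrightarrow> pint y \<Longrightarrow> pint (x - y)"
  using pint_add[of x "- y"] by auto

lemma pint_power [simp]: "pint x \<Longrightarrow> pint (x ^ n)"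
  by (induction n) auto

lemma pint_sum [intro]: "(\<And>i. i \<in> A \<Longrightarrow> pint (f i)) \<Longrightarrow> pint (sum f A)"
  by (induction A rule: infinite_finite_induct) auto

lemma pint_inverse:
  assumes "0 < k" "k < p" shows "pint (1 / of_nat k)"
proof -
  have "\<not> p dvd k" using assms by (auto dest: dvd_imp_le)
  then have "\<not> int p dvd int k" by simp
  then show ?thesis unfolding pint_iff by (intro exI[of _ 1] exI[of _ "int k"]) auto
qed

lemma pint_divide_nat:
  assumes "pint x" "0 < k" "k < p" shows "pint (x / of_nat k)"
  using pint_mult[OF assms(1) pint_inverse[OF assms(2,3)]] by simp

definition pcong :: "nat \<Rightarrow> rat \<Rightarrow> rat \<Rightarrow> bool" where
  "pcong m x y \<longleftrightarrow> pint ((x - y) / P ^ m)"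

lemma pcong_iff: "pcong m x y \<longleftrightarrow> (\<exists>z. pint z \<and> x = y + P ^ m * z)"
proof
  assume "pcong m x y"
  then show "\<exists>z. pint z \<and> x = y + P ^ m * z"
    unfolding pcong_def by (intro exI[of _ "(x - y) / P ^ m"]) simp
qed (auto simp: pcong_def)

lemma pcongI: "pint z \<Longrightarrow> x = y + P ^ m * z \<Longrightarrow> pcong m x y"
  by (auto simp: pcong_iff)

lemma pcong_refl [simp, intro]: "pcong m x x"
  by (simp add: pcong_def)

lemma pcong_sym: "pcong m x y \<Longrightarrow> pcong m y x"
  unfolding pcong_def using pint_minus[of "(x - y) / P ^ m"] by (simp add: minus_divide_left)

lemma pcong_add:
  assumes "pcong m x y" "pcong m x' y'" shows "pcong m (x + x') (y + y')"
  using pint_add[OF assms[unfolded pcong_def]] unfolding pcong_def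
  by (simp add: add_divide_distrib[symmetric] algebra_simps)

lemma pcong_trans [trans]:
  assumes "pcong m x y" "pcong m y z" shows "pcong m x z"
  using pint_add[OF assms[unfolded pcong_def]] unfolding pcong_def
  by (simp add: add_divide_distrib[symmetric])

lemma pcong_scale: "pcong m x y \<Longrightarrow> pint c \<Longrightarrow> pcong m (c * x) (c * y)"
  unfolding pcong_def using pint_mult[of c "(x - y) / P ^ m"] by (simp add: right_diff_distrib)

lemma pcong_diff: "pcong m x y \<Longrightarrow> pcong m x' y' \<Longrightarrow> pcong m (x - x') (y - y')"
  using pcong_add[of m x y "- x'" "- y'"] pcong_scale[of m x' y' "- 1"] by simp

lemma pcong_mult:
  assumes "pcong m x y" "pcong m x' y'" "pint y" "pint x'" shows "pcong m (x * x') (y * y')"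
proof -
  have "pcong m (x' * x) (x' * y)" using assms by (intro pcong_scale)
  moreover have "pcong m (y * x') (y * y')" using assms by (intro pcong_scale)
  ultimately show ?thesis by (metis mult.commute pcong_trans)
qed

lemma pcong_sum: "(\<And>i. i \<in> A \<Longrightarrow> pcong m (f i) (g i)) \<Longrightarrow> pcong m (sum f A) (sum g A)"
  by (induction A rule: infinite_finite_induct) (auto intro: pcong_add)

lemma pcong_lift: "pcong m x y \<Longrightarrow> pcong (m + k) (P ^ k * x) (P ^ k * y)"
  unfolding pcong_def by (simp add: power_add right_diff_distrib[symmetric])

lemma pcong_pint: "pcong m x y \<Longrightarrow> pint y \<Longrightarrow> pint x"
  by (auto simp: pcong_iff)

text \<open>
The only expansion of products that is used. With \<open>m = 1\<close> it gives binomial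
coefficients modulo \<open>p\<^sup>2\<close>, with \<open>m = 2\<close> the central one modulo \<open>p\<^sup>4\<close>.
\<close>

lemma prod_one_plus_pcong:
  assumes "finite S" "\<And>j. j \<in> S \<Longrightarrow> pint (x j)"
  shows "pcong (2 * m) (\<Prod>j\<in>S. 1 + P ^ m * x j) (1 + P ^ m * (\<Sum>j\<in>S. x j))"
  using assms
proof (induction S rule: finite_induct)
  case empty
  then show ?case by simp
next
  case (insert i S)
  then obtain z where z: "pint z" "(\<Prod>j\<in>S. 1 + P ^ m * x j) = 1 + P ^ m * (\<Sum>j\<in>S. x j) + P ^ (2 * m) * z"
    by (auto simp: pcong_iff)
  have ints: "pint (sum x S)" "pint (x i)" using insert.prems by auto
  have sq: "P ^ (2 * m) = P ^ m * P ^ m" by (simp add: mult_2 power_add)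
  have "(\<Prod>j\<in>insert i S. 1 + P ^ m * x j) = (1 + P ^ m * x i) * (\<Prod>j\<in>S. 1 + P ^ m * x j)"
    using insert.hyps by simp
  also have "\<dots> = 1 + P ^ m * (\<Sum>j\<in>insert i S. x j)
      + P ^ (2 * m) * (x i * sum x S + z * (1 + P ^ m * x i))"
    unfolding z(2) sum.insert[OF insert.hyps] sq by (simp add: algebra_simps)
  finally show ?case
    using ints z(1) by (intro pcongI[of "x i * sum x S + z * (1 + P ^ m * x i)"]) simp_all
qed

lemma fermat_pcong:
  assumes "0 < k" "k < p" shows "pcong 1 (of_nat k ^ (p - 1)) 1"
proof -
  have "\<not> p dvd k" using assms by (auto dest: dvd_imp_le)
  then have "[k ^ (p - 1) = 1] (mod p)"
    using prime_p by (intro fermat_theorem) auto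
  then have "[int (k ^ (p - 1)) = int 1] (mod int p)"
    by (simp only: cong_int_iff)
  then obtain z where "int (k ^ (p - 1)) = int 1 + int p * z"
    by (metis cong_iff_lin cong_sym)
  then have "of_int (int (k ^ (p - 1))) = (of_int (int 1 + int p * z) :: rat)" by (simp only:)
  then show ?thesis by (intro pcongI[of "of_int z"]) auto
qed

lemma inverse_power_pcong:
  assumes "0 < k" "k < p" "a \<le> p - 1"
  shows "pcong 1 (1 / of_nat k ^ a) (of_nat k ^ (p - 1 - a))"
proof -
  have "pint ((1 / of_nat k) ^ a)" using assms pint_inverse by auto
  from pcong_scale[OF fermat_pcong[OF assms(1,2)] this]
  have "pcong 1 (of_nat k ^ (p - 1) / of_nat k ^ a) (1 / of_nat k ^ a)"
    by (simp add: power_divide)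
  moreover have "of_nat k ^ (p - 1 - a) = (of_nat k ^ (p - 1) / of_nat k ^ a :: rat)"
    using assms by (intro power_diff) auto
  ultimately show ?thesis using pcong_sym by simp
qed

text \<open>
The easy part of von Staudt's theorem: the recurrence for \<open>bernoulli i\<close> only
divides by \<open>i + 1\<close> and smaller numbers.
\<close>

lemma pint_bernoulli: "i + 1 < p \<Longrightarrow> pint (bernoulli i)"
proof (induction i rule: less_induct)
  case (less i)
  show ?case
  proof (cases "i = 0")
    case False
    have "pint (- (\<Sum>k<i. of_nat (Suc i choose k) * bernoulli k))"
      using less by (intro pint_minus pint_sum pint_mult) auto
    then have "pint (- (\<Sum>k<i. of_nat (Suc i choose k) * bernoulli k) / of_nat (Suc i))"
      using less.prems by (intro pint_divide_nat) auto
    then show ?thesis using False by (subst bernoulli.simps) (simp del: of_nat_Suc)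
  qed (simp add: bernoulli_0)
qed

text \<open>
By Faulhaber's formula with upper limit \<open>p\<close>, every term carries a factor \<open>p\<close>; the
Bernoulli numbers and the divisor \<open>e + 1\<close> cause no denominators because \<open>e + 1 < p\<close>.
\<close>

lemma power_sum_pcong_0:
  assumes "1 \<le> e" "e \<le> p - 2"
  shows "pcong 1 (\<Sum>k\<in>{1..<p}. of_nat k ^ e) 0"
proof -
  have "p \<ge> 3" using assms by auto
  define r where "r = (\<Sum>i\<le>e. of_nat (Suc e choose i) * bernoulli i * P ^ (e - i))"
  have "(\<Sum>k\<in>{1..<p}. of_nat k ^ e) = (\<Sum>k<p. of_nat k ^ e :: rat)"
    using assms by (intro sum.mono_neutral_left) auto
  also have "of_nat (Suc e) * \<dots> = (\<Sum>i\<le>e. of_nat (Suc e choose i) * bernoulli i * P ^ (Suc e - i))"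
    by (rule faulhaber)
  also have "\<dots> = P * r"
    unfolding r_def sum_distrib_left by (intro sum.cong) (auto simp: Suc_diff_le)
  finally have "of_nat (Suc e) * (\<Sum>k\<in>{1..<p}. of_nat k ^ e) = P * r" .
  then have "(\<Sum>k\<in>{1..<p}. of_nat k ^ e) = P * (r / of_nat (Suc e))"
    by (simp add: eq_divide_eq mult.commute del: of_nat_Suc)
  moreover have "pint r" unfolding r_def
    using assms \<open>p \<ge> 3\<close> by (intro pint_sum pint_mult pint_bernoulli) auto
  then have "pint (r / of_nat (Suc e))"
    using assms \<open>p \<ge> 3\<close> by (intro pint_divide_nat) auto
  ultimately show ?thesis
    by (intro pcongI[of "r / of_nat (Suc e)"]) (simp_all only: power_one_right add_0_left)
qed

lemma inverse_power_sum_pcong_0: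
  assumes "1 \<le> a" "a \<le> p - 2"
  shows "pcong 1 (\<Sum>k\<in>{1..<p}. 1 / of_nat k ^ a) 0"
proof -
  have "pcong 1 (\<Sum>k\<in>{1..<p}. 1 / of_nat k ^ a) (\<Sum>k\<in>{1..<p}. of_nat k ^ (p - 1 - a))"
    using assms by (intro pcong_sum inverse_power_pcong) auto
  also have "pcong 1 \<dots> 0" using assms by (intro power_sum_pcong_0) auto
  finally show ?thesis .
qed

section \<open>A nested harmonic sum and the Bernoulli number\<close>

text \<open>
The upper limit is excluded because the products in the binomial
coefficients below run over \<open>j < k\<close>, once the factor for \<open>j = k\<close> is split off.
\<close>

definition harm_below :: "nat \<Rightarrow> rat" where
  "harm_below k = (\<Sum>j\<in>{1..<k}. 1 / of_nat j)"

definition nested_harm :: rat where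
  "nested_harm = (\<Sum>k\<in>{1..<p}. harm_below k / of_nat k ^ 2)"

lemma pint_harm_below: "k \<le> p \<Longrightarrow> pint (harm_below k)"
  unfolding harm_below_def by (intro pint_sum pint_inverse) auto

text \<open>
Modulo \<open>p\<close>, the inner sum is a sum of powers \<open>j ^ (p - 2)\<close>, so by Faulhaber's formula a
polynomial in \<open>k\<close> whose coefficients are multiples of Bernoulli numbers. Dividing by \<open>k\<^sup>2\<close> and
summing over \<open>k\<close> kills every power except the constant one, which comes from index \<open>p - 3\<close>.
\<close>

lemma nested_harm_pcong:
  assumes "p > 3"
  shows "pcong 1 nested_harm (bernoulli (p - 3))"
proof -
  define c where "c i = of_nat ((p - 1) choose i) * bernoulli i / of_nat (p - 1)" for i
  have pint_c: "pint (c i)" if "i \<le> p - 2" for i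
    unfolding c_def using that assms by (intro pint_divide_nat pint_mult pint_bernoulli) auto
  have faul: "(\<Sum>j\<in>{1..<k}. of_nat j ^ (p - 2)) = (\<Sum>i\<le>p - 2. c i * of_nat k ^ (p - 1 - i))" for k
  proof -
    have "(\<Sum>j\<in>{1..<k}. of_nat j ^ (p - 2)) = (\<Sum>j<k. of_nat j ^ (p - 2) :: rat)"
      using assms by (intro sum.mono_neutral_left) auto
    moreover have "Suc (p - 2) = p - 1" using assms by simp
    ultimately have "of_nat (p - 1) * (\<Sum>j\<in>{1..<k}. of_nat j ^ (p - 2))
       = (\<Sum>i\<le>p - 2. of_nat ((p - 1) choose i) * bernoulli i * of_nat k ^ (p - 1 - i))"
      using faulhaber[of "p - 2" k] by simp
    then have "(\<Sum>j\<in>{1..<k}. of_nat j ^ (p - 2))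
       = (\<Sum>i\<le>p - 2. of_nat ((p - 1) choose i) * bernoulli i * of_nat k ^ (p - 1 - i)) / of_nat (p - 1)"
      using assms by (simp add: eq_divide_eq mult.commute)
    then show ?thesis by (simp add: c_def sum_divide_distrib)
  qed
  define q where "q e = (\<Sum>k\<in>{1..<p}. of_nat k ^ e / of_nat k ^ 2 :: rat)" for e
  have q_shift: "q (e + 2) = (\<Sum>k\<in>{1..<p}. of_nat k ^ e)" for e
    unfolding q_def by (intro sum.cong) (auto simp: power2_eq_square)
  have q_vanish: "pcong 1 (q (p - 1 - i)) 0" if "i \<le> p - 2" "i \<noteq> p - 3" for i
  proof (cases "i = p - 2")
    case True
    then have "q (p - 1 - i) = (\<Sum>k\<in>{1..<p}. 1 / of_nat k ^ 1)"
      using assms unfolding q_def by (intro sum.cong) (auto simp: power2_eq_square Suc_diff_Suc numeral_2_eq_2)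
    then show ?thesis using inverse_power_sum_pcong_0[of 1] assms by simp
  next
    case False
    then have "p - 1 - i = (p - 3 - i) + 2" using that assms by auto
    then have "q (p - 1 - i) = (\<Sum>k\<in>{1..<p}. of_nat k ^ (p - 3 - i))" using q_shift by simp
    then show ?thesis using power_sum_pcong_0[of "p - 3 - i"] that assms False by auto
  qed
  have q_main: "q (p - 1 - (p - 3)) = of_nat (p - 1)"
  proof -
    have "p - 1 - (p - 3) = 0 + 2" using assms by simp
    then show ?thesis using q_shift[of 0] by simp
  qed
  have "pcong 1 nested_harm (\<Sum>k\<in>{1..<p}. (1 / of_nat k) ^ 2 * (\<Sum>j\<in>{1..<k}. of_nat j ^ (p - 2)))"
  proof -
    have "pcong 1 (harm_below k) (\<Sum>j\<in>{1..<k}. of_nat j ^ (p - 2))" if "k < p" for k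
      unfolding harm_below_def
    proof (intro pcong_sum)
      fix j assume "j \<in> {1..<k}"
      then show "pcong 1 (1 / of_nat j) (of_nat j ^ (p - 2))"
        using inverse_power_pcong[of j 1] that assms by (simp add: numeral_2_eq_2)
    qed
    then have "pcong 1 ((1 / of_nat k) ^ 2 * harm_below k)
                 ((1 / of_nat k) ^ 2 * (\<Sum>j\<in>{1..<k}. of_nat j ^ (p - 2)))" if "k \<in> {1..<p}" for k
      using that by (intro pcong_scale pint_power pint_inverse) auto
    from pcong_sum[OF this, of "{1..<p}"] show ?thesis
      by (simp add: nested_harm_def power_divide)
  qed
  also have "(\<Sum>k\<in>{1..<p}. (1 / of_nat k) ^ 2 * (\<Sum>j\<in>{1..<k}. of_nat j ^ (p - 2)))
     = (\<Sum>i\<le>p - 2. c i * q (p - 1 - i))"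
    unfolding faul q_def sum_distrib_left
    by (subst sum.swap) (simp add: power_divide)
  also have "pcong 1 \<dots> (\<Sum>i\<le>p - 2. if i = p - 3 then c i * of_nat (p - 1) else 0)"
  proof (intro pcong_sum)
    fix i assume i: "i \<in> {..p - 2}"
    show "pcong 1 (c i * q (p - 1 - i)) (if i = p - 3 then c i * of_nat (p - 1) else 0)"
      using pcong_scale[OF q_vanish pint_c, of i i] i q_main by auto
  qed
  also have "\<dots> = c (p - 3) * of_nat (p - 1)"
    using assms by (subst sum.delta) auto
  also have "\<dots> = of_nat ((p - 1) choose 2) * bernoulli (p - 3)"
  proof -
    have "((p - 1) choose (p - 3)) = ((p - 1) choose 2)"
      using assms by (subst binomial_symmetric) auto
    then show ?thesis using assms by (simp add: c_def)
  qed
  also have "pcong 1 \<dots> (1 * bernoulli (p - 3))"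
  proof (intro pcong_mult)
    have "odd p" using prime_p assms by (simp add: prime_odd_nat)
    then obtain h where h: "p = 2 * h + 1" by (elim oddE)
    \<comment> \<open>Modulo \<open>p\<close>, \<open>(p - 1) (p - 2) / 2\<close> is \<open>(- 1) (- 2) / 2 = 1\<close>.\<close>
    have "(p - 1) choose 2 = h * (2 * h - 1)" by (simp add: h choose_two)
    moreover have "of_nat (h * (2 * h - 1)) = 1 + P * (of_nat h - 1)"
      using assms h by (cases h) (auto simp: algebra_simps)
    ultimately show "pcong 1 (of_nat ((p - 1) choose 2)) 1"
      by (intro pcongI[of "of_nat h - 1"]) auto
  qed (use assms in \<open>auto intro: pint_bernoulli\<close>)
  finally show ?thesis by simp
qed

end

section \<open>Binomial coefficients near a prime\<close>

lemma binomial_add_eq_prod: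
  "of_nat ((n + k) choose k) = (\<Prod>j\<in>{1..<Suc k}. 1 + of_nat n * (1 / of_nat j) :: rat)"
proof (induction k)
  case 0
  then show ?case by simp
next
  case (Suc k)
  have "of_nat (Suc k) * of_nat (Suc (n + k) choose Suc k) = (of_nat (Suc (n + k)) * of_nat ((n + k) choose k) :: rat)"
    using Suc_times_binomial[of k "n + k"] by (metis of_nat_mult)
  then have "of_nat ((n + Suc k) choose Suc k) = of_nat ((n + k) choose k) * (1 + of_nat n * (1 / of_nat (Suc k)) :: rat)"
    by (simp add: field_simps del: binomial_Suc_Suc)
  then show ?case using Suc by simp
qed

lemma binomial_eq_signed_prod:
  "of_nat (n choose k) = (-1)^k * (\<Prod>j\<in>{1..<Suc k}. 1 - (of_nat n + 1) * (1 / of_nat j) :: rat)"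
proof (induction k)
  case 0
  then show ?case by simp
next
  case (Suc k)
  have "of_nat (Suc k) * of_nat (Suc n choose Suc k) = (of_nat (Suc n) * of_nat (n choose k) :: rat)"
    using Suc_times_binomial[of k n] by (metis of_nat_mult)
  then have "of_nat (n choose Suc k) = of_nat (n choose k) * - (1 - (of_nat n + 1) * (1 / of_nat (Suc k)) :: rat)"
    by (simp add: field_simps)
  moreover have "{1..<Suc (Suc k)} = insert (Suc k) {1..<Suc k}" by auto
  then have "(\<Prod>j\<in>{1..<Suc (Suc k)}. 1 - (of_nat n + 1) * (1 / of_nat j) :: rat)
      = (1 - (of_nat n + 1) * (1 / of_nat (Suc k))) * (\<Prod>j\<in>{1..<Suc k}. 1 - (of_nat n + 1) * (1 / of_nat j))"
    by (simp only: prod.insert finite_atLeastLessThan atLeastLessThan_iff less_irrefl simp_thms if_False)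
  ultimately show ?case
    by (simp only: Suc power_Suc mult_minus_left mult_minus_right mult_1 mult_ac)
qed

context p_adic
begin

definition prod_plus :: "nat \<Rightarrow> rat" where
  "prod_plus k = (\<Prod>j\<in>{1..<k}. 1 + P * (1 / of_nat j))"

definition prod_minus :: "nat \<Rightarrow> rat" where
  "prod_minus k = (\<Prod>j\<in>{1..<k}. 1 - P * (1 / of_nat j))"

lemma prod_plus_expand:
  assumes "k \<le> p"
  obtains u where "pint u" "prod_plus k = 1 + P * harm_below k + P ^ 2 * u"
proof -
  have "pcong (2 * 1) (\<Prod>j\<in>{1..<k}. 1 + P ^ 1 * (1 / of_nat j)) (1 + P ^ 1 * (\<Sum>j\<in>{1..<k}. 1 / of_nat j))"
    using assms by (intro prod_one_plus_pcong pint_inverse) auto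
  then have "pcong 2 (prod_plus k) (1 + P * harm_below k)"
    by (simp add: prod_plus_def harm_below_def)
  then show ?thesis using that by (auto simp: pcong_iff)
qed

lemma prod_minus_expand:
  assumes "k \<le> p"
  obtains u where "pint u" "prod_minus k = 1 - P * harm_below k + P ^ 2 * u"
proof -
  have "pcong (2 * 1) (\<Prod>j\<in>{1..<k}. 1 + P ^ 1 * - (1 / of_nat j)) (1 + P ^ 1 * (\<Sum>j\<in>{1..<k}. - (1 / of_nat j)))"
    using assms by (intro prod_one_plus_pcong pint_minus pint_inverse) auto
  then have "pcong 2 (prod_minus k) (1 - P * harm_below k)"
    by (simp add: prod_minus_def harm_below_def sum_negf)
  then show ?thesis using that by (auto simp: pcong_iff)
qed

lemma
  assumes "k \<in> {1..<p}"
  shows binomial_p: "of_nat (p choose k) = P / of_nat k * ((-1)^(k - 1) * prod_minus k)" (is ?A)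
    and binomial_p_plus: "of_nat ((p + k) choose k) = prod_plus k * (1 + P / of_nat k)" (is ?B)
    and binomial_p_minus_1: "of_nat ((p - 1) choose k) = (-1)^k * (prod_minus k * (1 - P / of_nat k))" (is ?C)
    and binomial_p_minus_1_plus: "of_nat ((p - 1 + k) choose k) = P / of_nat k * prod_plus k" (is ?D)
proof -
  obtain i where k: "k = Suc i" using assms by (cases k) auto
  obtain m where p: "p = Suc m" using assms by (cases p) auto
  have P: "of_nat (p - 1) + 1 = P" by (simp add: p)
  have minus: "of_nat ((p - 1) choose i) = (-1)^i * prod_minus (Suc i)" for i
    using binomial_eq_signed_prod[of "p - 1" i] by (simp only: prod_minus_def P)
  have plus: "of_nat ((p + i) choose i) = prod_plus (Suc i)" for i
    unfolding prod_plus_def by (rule binomial_add_eq_prod)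
  have "of_nat (Suc i) * of_nat (Suc m choose Suc i) = (of_nat (Suc m) * of_nat (m choose i) :: rat)"
    using Suc_times_binomial[of i m] by (metis of_nat_mult)
  moreover have "of_nat (m choose i) = (-1)^i * prod_minus k" using minus[of i] by (simp add: p k)
  ultimately show ?A unfolding p k by (simp add: field_simps del: of_nat_Suc)
  show ?B using plus[of k] by (simp add: prod_plus_def k)
  show ?C using minus[of k] by (simp add: prod_minus_def k)
  have "Suc i * ((m + Suc i) choose Suc i) = Suc m * ((Suc m + i) choose i)"
  proof -
    have "Suc m * (Suc (m + i) choose Suc m) = Suc (m + i) * ((m + i) choose m)"
      by (rule Suc_times_binomial)
    moreover have "Suc (m + i) choose Suc m = (Suc m + i) choose i"
      by (subst binomial_symmetric) auto
    moreover have "(m + i) choose m = (m + i) choose i"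
      by (subst binomial_symmetric) auto
    ultimately show ?thesis using Suc_times_binomial[of i "m + i"] by simp
  qed
  then have "of_nat (Suc i) * of_nat ((p - 1 + k) choose k) = P * of_nat ((p + i) choose i)"
    unfolding p k by (metis of_nat_mult diff_Suc_1)
  then show ?D using plus[of i] by (simp add: k field_simps del: of_nat_Suc)
qed

definition harm2 :: rat where
  "harm2 = (\<Sum>k\<in>{1..<p}. 1 / of_nat k ^ 2)"

definition harm3 :: rat where
  "harm3 = (\<Sum>k\<in>{1..<p}. 1 / of_nat k ^ 3)"

text \<open>
The shape of all three sums of binomial products below, to the order needed: a common factor
\<open>p\<^sup>2 / k\<^sup>2\<close> times a first-order expansion.
\<close>

lemma sum_weighted_square_reciprocals:
  "(\<Sum>k\<in>{1..<p}. P^2 * (1 / of_nat k)^2 * (1 + a * P * harm_below k + b * P * (1 / of_nat k)))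
     = P^2 * harm2 + a * P^3 * nested_harm + b * P^3 * harm3"
  by (simp add: harm2_def nested_harm_def harm3_def sum_distrib_left sum.distrib[symmetric]
        field_simps power2_eq_square power3_eq_cube)

text \<open>
The factor \<open>p\<^sup>2\<close> in front is why an expansion of \<open>g k\<close> modulo \<open>p\<^sup>2\<close> determines the sum modulo \<open>p\<^sup>4\<close>.
\<close>

lemma pcong_sum_terms:
  assumes "\<And>k. k \<in> {1..<p} \<Longrightarrow> f k = P^2 * (1 / of_nat k)^2 * g k"
    and "\<And>k. k \<in> {1..<p} \<Longrightarrow> \<exists>z. pint z \<and> g k = 1 + a * P * harm_below k + b * P * (1 / of_nat k) + P^2 * z"
  shows "pcong 4 (\<Sum>k\<in>{1..<p}. f k) (P^2 * harm2 + a * P^3 * nested_harm + b * P^3 * harm3)"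
  unfolding sum_weighted_square_reciprocals[symmetric]
proof (intro pcong_sum)
  fix k assume k: "k \<in> {1..<p}"
  then obtain z where z: "pint z" "g k = 1 + a * P * harm_below k + b * P * (1 / of_nat k) + P^2 * z"
    using assms(2) by blast
  have "pint (1 / of_nat k)" using k pint_inverse by auto
  then have "pint ((1 / of_nat k)^2 * z)" using z by (intro pint_mult pint_power)
  moreover have "f k = P^2 * (1 / of_nat k)^2 * (1 + a * P * harm_below k + b * P * (1 / of_nat k))
      + P ^ 4 * ((1 / of_nat k)^2 * z)"
    unfolding assms(1)[OF k] z(2) by (simp add: algebra_simps power2_eq_square power4_eq_xxxx)
  ultimately show "pcong 4 (f k) (P^2 * (1 / of_nat k)^2 * (1 + a * P * harm_below k + b * P * (1 / of_nat k)))"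
    by (intro pcongI)
qed

lemma sum_atMost_split:
  fixes n :: nat
  assumes "n \<ge> 1"
  shows "(\<Sum>k\<le>n. f k) = f 0 + (\<Sum>k\<in>{1..<n}. f k) + (f n :: rat)"
proof -
  have "{..n} = insert 0 (insert n {1..<n})" using assms by auto
  then show ?thesis using assms by (simp add: add_ac)
qed

text \<open>
Names for the quantities that occur at one \<open>k\<close>; with them, a congruence between products of
binomial coefficients becomes a polynomial identity with an explicit remainder.
\<close>

lemma expand_at:
  assumes "k \<in> {1..<p}"
  obtains h t u v where "pint h" "pint t" "pint u" "pint v" "harm_below k = h" "1 / of_nat k = t"
    "prod_minus k = 1 - P * h + P^2 * u" "prod_plus k = 1 + P * h + P^2 * v"
proof -
  obtain u where "pint u" "prod_minus k = 1 - P * harm_below k + P^2 * u"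
    using prod_minus_expand[of k] assms by auto
  moreover obtain v where "pint v" "prod_plus k = 1 + P * harm_below k + P^2 * v"
    using prod_plus_expand[of k] assms by auto
  ultimately show ?thesis
    using that[of "harm_below k" "1 / of_nat k" u v] pint_harm_below[of k] pint_inverse[of k] assms
    by simp
qed

section \<open>Two evaluations of the central binomial coefficient\<close>

lemma central_binomial_sum_pcong:
  "pcong 4 (of_nat ((2 * p) choose p)) (2 + P^2 * harm2 - 2 * P^3 * nested_harm)"
proof -
  have "(2 * p) choose p = (\<Sum>k\<le>p. (p choose k)^2)"
    by (rule choose_square_sum[symmetric])
  then have "of_nat ((2 * p) choose p) = (\<Sum>k\<le>p. of_nat (p choose k)^2 :: rat)"
    by (simp only: of_nat_sum of_nat_power)
  also have "\<dots> = 2 + (\<Sum>k\<in>{1..<p}. of_nat (p choose k)^2)"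
    using prime_gt_1_nat[OF prime_p] by (subst sum_atMost_split) auto
  also have "pcong 4 \<dots> (2 + (P^2 * harm2 + (- 2) * P^3 * nested_harm + 0 * P^3 * harm3))"
  proof (intro pcong_add pcong_refl pcong_sum_terms)
    fix k assume k: "k \<in> {1..<p}"
    show "of_nat (p choose k)^2 = P^2 * (1 / of_nat k)^2 * (prod_minus k)^2"
      unfolding binomial_p[OF k] by (simp add: power_mult_distrib power_divide flip: power_mult)
    obtain h t u v where e: "pint h" "pint t" "pint u" "pint v" "harm_below k = h" "1 / of_nat k = t"
      "prod_minus k = 1 - P * h + P^2 * u" "prod_plus k = 1 + P * h + P^2 * v"
      by (rule expand_at[OF k])
    show "\<exists>z. pint z \<and> (prod_minus k)^2 = 1 + (- 2) * P * harm_below k + 0 * P * (1 / of_nat k) + P^2 * z"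
      unfolding e(5-8) using e(1-4)
      by (intro exI[of _ "h^2 + P^2 * u^2 + 2 * u - 2 * P * h * u"])
        (simp add: algebra_simps power2_eq_square)
  qed
  also have "2 + (P^2 * harm2 + (- 2) * P^3 * nested_harm + 0 * P^3 * harm3)
      = 2 + P^2 * harm2 - 2 * P^3 * nested_harm" by simp
  finally show ?thesis .
qed

text \<open>
The product of \<open>1 - p / j\<close> over \<open>j < p\<close> equals 1, because \<open>(p - 1) choose (p - 1) = 1\<close>.
Multiplying by it turns the factors \<open>1 + p / j\<close> into \<open>1 - p\<^sup>2 / j\<^sup>2\<close>, so that
the first-order expansion is accurate to \<open>p\<^sup>4\<close>.
\<close>

lemma central_binomial_pcong:
  assumes "odd p"
  shows "pcong 4 (of_nat ((2 * p) choose p)) (2 - 2 * P^2 * harm2)"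
proof -
  obtain m where p: "p = Suc m" using p_nonzero by (cases p) auto
  have "prod_minus p = 1"
  proof -
    have "of_nat (p - 1) + 1 = P" by (simp add: p)
    then have "of_nat ((p - 1) choose m) = (-1)^m * prod_minus (Suc m)"
      using binomial_eq_signed_prod[of "p - 1" m] by (simp only: prod_minus_def)
    moreover have "p - 1 = m" "Suc m = p" "even m" using assms p by auto
    ultimately show ?thesis by simp
  qed
  moreover have "of_nat ((2 * p) choose p) = prod_plus p * 2"
  proof -
    have ins: "{1..<Suc p} = insert p {1..<p}" using p by auto
    have "of_nat ((2 * p) choose p) = (\<Prod>j\<in>{1..<Suc p}. 1 + P * (1 / of_nat j))"
      unfolding mult_2 by (rule binomial_add_eq_prod)
    also have "\<dots> = (1 + P * (1 / P)) * prod_plus p"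
      unfolding ins prod_plus_def by (subst prod.insert) auto
    finally show ?thesis by simp
  qed
  ultimately have "of_nat ((2 * p) choose p) = 2 * (prod_plus p * prod_minus p)" by simp
  also have "prod_plus p * prod_minus p = (\<Prod>j\<in>{1..<p}. 1 + P ^ 2 * - ((1 / of_nat j)^2))"
    unfolding prod_plus_def prod_minus_def prod.distrib[symmetric]
    by (intro prod.cong refl) (simp add: algebra_simps power2_eq_square)
  also have "pcong 4 (2 * \<dots>) (2 * (1 + P^2 * (\<Sum>j\<in>{1..<p}. - ((1 / of_nat j)^2))))"
  proof (intro pcong_scale)
    have "pcong (2 * 2) (\<Prod>j\<in>{1..<p}. 1 + P ^ 2 * - ((1 / of_nat j)^2))
        (1 + P^2 * (\<Sum>j\<in>{1..<p}. - ((1 / of_nat j)^2)))"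
      by (intro prod_one_plus_pcong pint_minus pint_power pint_inverse) auto
    then show "pcong 4 (\<Prod>j\<in>{1..<p}. 1 + P ^ 2 * - ((1 / of_nat j)^2))
        (1 + P^2 * (\<Sum>j\<in>{1..<p}. - ((1 / of_nat j)^2)))"
      by simp
  qed simp
  also have "2 * (1 + P^2 * (\<Sum>j\<in>{1..<p}. - ((1 / of_nat j)^2))) = 2 - 2 * P^2 * harm2"
    by (simp add: harm2_def sum_negf power_divide algebra_simps)
  finally show ?thesis .
qed

text \<open>
Comparing the two evaluations of \<open>(2 p) choose p\<close> expresses \<open>harm2\<close> modulo \<open>p\<^sup>2\<close> by
a sum that is needed modulo \<open>p\<close> only, in place of Bernoulli numbers of
index beyond \<open>p\<close> and Kummer's congruences.
\<close>

lemma harm2_nested_harm_pcong: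
  assumes "p > 3"
  shows "pcong 4 (P^2 * harm2) (2/3 * P^3 * nested_harm)"
proof -
  have "odd p" using prime_p assms by (simp add: prime_odd_nat)
  have "pcong 4 (2 + P^2 * harm2 - 2 * P^3 * nested_harm) (2 - 2 * P^2 * harm2)"
    using pcong_sym[OF central_binomial_sum_pcong] central_binomial_pcong[OF \<open>odd p\<close>]
    by (rule pcong_trans)
  from pcong_diff[OF this pcong_refl, of "2 - 2 * P^2 * harm2 - 2 * P^3 * nested_harm"]
  have "pcong 4 (3 * (P^2 * harm2)) (2 * P^3 * nested_harm)" by (simp add: algebra_simps)
  from pcong_scale[OF this pint_inverse[of 3]] show ?thesis
    using assms by simp
qed

lemma harm3_pcong:
  assumes "p > 3" shows "pcong 4 (P^3 * harm3) 0"
proof -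
  have "p \<noteq> 4" using prime_p by auto
  then have "pcong 1 harm3 0"
    unfolding harm3_def using assms by (intro inverse_power_sum_pcong_0) auto
  from pcong_lift[OF this, of 3] show ?thesis by simp
qed

section \<open>The two boundary values and the congruence\<close>

lemma apery'_p_pcong:
  assumes "p > 3"
  shows "pcong 4 (of_nat (apery' p)) (3 - 5/3 * P^3 * nested_harm)"
proof -
  have "odd p" using prime_p assms by (simp add: prime_odd_nat)
  have "of_nat (apery' p) = (\<Sum>k\<le>p. apery_term p k)"
    by (rule apery'_eq_sum_terms) simp
  also have "\<dots> = 1 + of_nat ((2 * p) choose p) + (\<Sum>k\<in>{1..<p}. apery_term p k)"
    using assms by (subst sum_atMost_split) (auto simp: apery_term_def mult_2)
  also have "pcong 4 \<dots> (1 + (2 - 2 * P^2 * harm2)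
      + (P^2 * harm2 + (- 1) * P^3 * nested_harm + 1 * P^3 * harm3))"
  proof (intro pcong_add pcong_refl central_binomial_pcong \<open>odd p\<close> pcong_sum_terms)
    fix k assume k: "k \<in> {1..<p}"
    show "apery_term p k = P^2 * (1 / of_nat k)^2 * ((prod_minus k)^2 * (prod_plus k * (1 + P * (1 / of_nat k))))"
      unfolding apery_term_def binomial_p[OF k] binomial_p_plus[OF k]
      by (simp add: power_mult_distrib power_divide flip: power_mult)
    obtain h t u v where e: "pint h" "pint t" "pint u" "pint v" "harm_below k = h" "1 / of_nat k = t"
      "prod_minus k = 1 - P * h + P^2 * u" "prod_plus k = 1 + P * h + P^2 * v"
      by (rule expand_at[OF k])
    have "pcong 2 ((prod_minus k)^2) (1 - 2 * P * h)"
      unfolding e(7) using e(1-4)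
      by (intro pcongI[of "h^2 + P^2 * u^2 + 2 * u - 2 * P * h * u"])
        (simp_all add: algebra_simps power2_eq_square)
    moreover have "pcong 2 (prod_plus k * (1 + P * t)) (1 + P * h + P * t)"
      unfolding e(8) using e(1-4)
      by (intro pcongI[of "h * t + v * (1 + P * t)"]) (simp_all add: algebra_simps power2_eq_square)
    ultimately have "pcong 2 ((prod_minus k)^2 * (prod_plus k * (1 + P * t))) ((1 - 2 * P * h) * (1 + P * h + P * t))"
      using e by (intro pcong_mult) auto
    also have "pcong 2 \<dots> (1 + (- 1) * P * h + 1 * P * t)"
      using e(1-4) by (intro pcongI[of "- 2 * h * (h + t)"]) (simp_all add: algebra_simps power2_eq_square)
    finally show "\<exists>z. pint z \<and> (prod_minus k)^2 * (prod_plus k * (1 + P * (1 / of_nat k)))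
        = 1 + (- 1) * P * harm_below k + 1 * P * (1 / of_nat k) + P^2 * z"
      by (simp only: pcong_iff e(5,6))
  qed
  also have "\<dots> = 3 - P^2 * harm2 - P^3 * nested_harm + P^3 * harm3" by simp
  also have "pcong 4 \<dots> (3 - 2/3 * P^3 * nested_harm - P^3 * nested_harm + 0)"
    using assms by (intro pcong_add pcong_diff pcong_refl harm2_nested_harm_pcong harm3_pcong)
  also have "\<dots> = 3 - 5/3 * P^3 * nested_harm" by simp
  finally show ?thesis .
qed

text \<open>
The alternating form is used, in which every term with \<open>k \<ge> 1\<close> has the factor \<open>p\<^sup>2\<close>.
\<close>

lemma apery'_p_minus_1_pcong:
  assumes "p > 3"
  shows "pcong 4 (of_nat (apery' (p - 1))) (1 + 5/3 * P^3 * nested_harm)"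
proof -
  have "odd p" using prime_p assms by (simp add: prime_odd_nat)
  define f :: "nat \<Rightarrow> rat" where
    "f k = (-1)^k * of_nat ((p - 1) choose k) * (of_nat ((p - 1 + k) choose k))^2" for k
  have "of_nat (apery' (p - 1)) = (-1)^(p - 1) * (\<Sum>k\<le>p - 1. f k)"
    unfolding f_def by (rule apery'_alternating_form)
  also have "\<dots> = (\<Sum>k\<in>insert 0 {1..<p}. f k)"
  proof -
    have "{..p - 1} = insert 0 {1..<p}" using assms by auto
    then show ?thesis using \<open>odd p\<close> by simp
  qed
  also have "\<dots> = 1 + (\<Sum>k\<in>{1..<p}. f k)" by (simp add: f_def)
  also have "pcong 4 \<dots> (1 + (P^2 * harm2 + 1 * P^3 * nested_harm + (- 1) * P^3 * harm3))"
  proof (intro pcong_add pcong_refl pcong_sum_terms)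
    fix k assume k: "k \<in> {1..<p}"
    show "f k = P^2 * (1 / of_nat k)^2 * ((prod_minus k * (1 - P * (1 / of_nat k))) * (prod_plus k)^2)"
      unfolding f_def binomial_p_minus_1[OF k] binomial_p_minus_1_plus[OF k]
      by (simp add: power_mult_distrib power_divide flip: power_mult)
    obtain h t u v where e: "pint h" "pint t" "pint u" "pint v" "harm_below k = h" "1 / of_nat k = t"
      "prod_minus k = 1 - P * h + P^2 * u" "prod_plus k = 1 + P * h + P^2 * v"
      by (rule expand_at[OF k])
    have "pcong 2 ((prod_plus k)^2) (1 + 2 * P * h)"
      unfolding e(8) using e(1-4)
      by (intro pcongI[of "h^2 + P^2 * v^2 + 2 * v + 2 * P * h * v"])
        (simp_all add: algebra_simps power2_eq_square)
    moreover have "pcong 2 (prod_minus k * (1 - P * t)) (1 - P * h - P * t)"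
      unfolding e(7) using e(1-4)
      by (intro pcongI[of "h * t + u * (1 - P * t)"]) (simp_all add: algebra_simps power2_eq_square)
    ultimately have "pcong 2 ((prod_minus k * (1 - P * t)) * (prod_plus k)^2) ((1 - P * h - P * t) * (1 + 2 * P * h))"
      using e by (intro pcong_mult) auto
    also have "pcong 2 \<dots> (1 + 1 * P * h + (- 1) * P * t)"
      using e(1-4) by (intro pcongI[of "- 2 * h * (h + t)"]) (simp_all add: algebra_simps power2_eq_square)
    finally show "\<exists>z. pint z \<and> (prod_minus k * (1 - P * (1 / of_nat k))) * (prod_plus k)^2
        = 1 + 1 * P * harm_below k + (- 1) * P * (1 / of_nat k) + P^2 * z"
      by (simp only: pcong_iff e(5,6))
  qed
  also have "\<dots> = 1 + P^2 * harm2 + P^3 * nested_harm - P^3 * harm3" by simp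
  also have "pcong 4 \<dots> (1 + 2/3 * P^3 * nested_harm + P^3 * nested_harm - 0)"
    using assms by (intro pcong_add pcong_diff pcong_refl harm2_nested_harm_pcong harm3_pcong)
  also have "\<dots> = 1 + 5/3 * P^3 * nested_harm" by simp
  finally show ?thesis .
qed

text \<open>
For \<open>p = 5\<close> the coefficient \<open>8 / 5\<close> of the closed form is not \<open>p\<close>-integral. The quadratic form that it
multiplies is constant to one power of \<open>p\<close> more than necessary, and this absorbs the
denominator.
\<close>

lemma pint_fifth_multiple:
  assumes "p > 3" shows "pint (P / 5)"
proof (cases "p = 5")
  case False
  have "p \<noteq> 4" using prime_p by auto
  then show ?thesis using assms False pint_divide_nat[of P 5] by simp
next
  case True
  then have "P / 5 = of_nat 1" by simp
  then show ?thesis by (simp only: pint_of_nat)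
qed

text \<open>
The product of the two boundary values occurs with the factor \<open>p\<^sup>2\<close> and is needed modulo \<open>p\<^sup>4\<close>. The
quadratic form occurs with the factor \<open>p\<^sup>4\<close>, and the values \<open>3\<close> and \<open>1\<close> modulo \<open>p\<^sup>3\<close> suffice for it:
\<open>9 - 33 - 1 = - 25\<close>.
\<close>

lemma squared_apery'_sum_pcong:
  assumes "p > 3"
  shows "pcong 6
    (\<Sum>n<p. (25 * (2 * of_nat n + 1)^3 + 3 * (2 * of_nat n + 1)) * (-1)^n * (of_nat (apery' n))^2)
    (- 12 * P ^ 2 + 40 * P ^ 4 - 40 / 3 * P ^ 5 * bernoulli (p - 3))"
proof -
  define a b B where "a = (of_nat (apery' p) :: rat)" and "b = (of_nat (apery' (p - 1)) :: rat)"
    and "B = bernoulli (p - 3)"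
  have "odd p" using prime_p assms by (simp add: prime_odd_nat)
  have B: "pint B" unfolding B_def using assms by (intro pint_bernoulli) auto
  have third: "pint (1 / 3)" using pint_inverse[of 3] assms by simp
  have TB: "pcong 4 (5/3 * P^3 * nested_harm) (5/3 * P^3 * B)"
  proof -
    have "pcong 4 (P^3 * nested_harm) (P^3 * B)"
      using pcong_lift[OF nested_harm_pcong[OF assms], of 3] by (simp add: B_def)
    moreover have "pint (5 * (1/3))" using third by (intro pint_mult) simp_all
    ultimately have "pcong 4 (5 * (1/3) * (P^3 * nested_harm)) (5 * (1/3) * (P^3 * B))"
      by (rule pcong_scale)
    then show ?thesis by (simp add: mult.assoc)
  qed
  have a: "pcong 4 a (3 - 5/3 * P^3 * B)"
    unfolding a_def by (rule pcong_trans[OF apery'_p_pcong[OF assms] pcong_diff[OF pcong_refl TB]])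
  have b: "pcong 4 b (1 + 5/3 * P^3 * B)"
    unfolding b_def by (rule pcong_trans[OF apery'_p_minus_1_pcong[OF assms] pcong_add[OF pcong_refl TB]])
  obtain u where u: "pint u" "a = 3 + P^3 * u"
  proof -
    obtain z where z: "pint z" "a = 3 - 5/3 * P^3 * B + P^4 * z" using a by (auto simp: pcong_iff)
    have "pint (P * z - 5 * ((1/3) * B))"
      using z(1) third B by (intro pint_diff pint_mult) simp_all
    moreover have "a = 3 + P^3 * (P * z - 5 * ((1/3) * B))"
      unfolding z(2) by (simp add: algebra_simps power3_eq_cube power4_eq_xxxx)
    ultimately show ?thesis by (rule that)
  qed
  obtain v where v: "pint v" "b = 1 + P^3 * v"
  proof -
    obtain z where z: "pint z" "b = 1 + 5/3 * P^3 * B + P^4 * z" using b by (auto simp: pcong_iff)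
    have "pint (P * z + 5 * ((1/3) * B))"
      using z(1) third B by (intro pint_add pint_mult) simp_all
    moreover have "b = 1 + P^3 * (P * z + 5 * ((1/3) * B))"
      unfolding z(2) by (simp add: algebra_simps power3_eq_cube power4_eq_xxxx)
    ultimately show ?thesis by (rule that)
  qed
  have "pcong 4 (a * b) ((3 - 5/3 * P^3 * B) * (1 + 5/3 * P^3 * B))"
  proof (intro pcong_mult a b)
    have "pint (3 - 5 * (1/3) * P^3 * B)" using third B by (intro pint_diff pint_mult) simp_all
    then show "pint (3 - 5/3 * P^3 * B)" by simp
    show "pint b" by (simp add: b_def)
  qed
  also have "pcong 4 \<dots> (3 + 10/3 * P^3 * B)"
  proof (rule pcongI)
    show "pint (- (25 * (1/3 * (P * B))^2))"
      using B third by (intro pint_minus pint_mult pint_power) simp_all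
    show "(3 - 5/3 * P^3 * B) * (1 + 5/3 * P^3 * B)
        = 3 + 10/3 * P^3 * B + P^4 * (- (25 * (1/3 * (P * B))^2))"
      by (simp add: algebra_simps power2_eq_square power3_eq_cube power4_eq_xxxx)
  qed
  finally have ab: "pcong 4 (a * b) (3 + 10/3 * P^3 * B)" .
  have main: "pcong 6 (- 4 * P^2 * (a * b)) (- 12 * P^2 - 40/3 * P^5 * B)"
    using pcong_scale[OF pcong_lift[OF ab, of 2], of "- 4"]
    by (simp add: algebra_simps eval_nat_numeral)
  define w where "w = - 5 * u - 35 * v + P^3 * (u^2 - 11 * u * v - v^2)"
  have quadratic: "a^2 - 11 * a * b - b^2 = - 25 + P^3 * w"
    unfolding u(2) v(2) w_def by (simp add: algebra_simps power2_eq_square)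
  have small: "pcong 6 (- (8/5 * P^4 * (a^2 - 11 * a * b - b^2))) (40 * P^4)"
  proof (rule pcongI)
    have "pint (- 5 * u - 35 * v + P^3 * (u^2 - 11 * u * v - v^2))"
      using u(1) v(1) by (intro pint_add pint_diff pint_mult pint_power) simp_all
    then show "pint (- (8 * (P / 5 * w)))"
      using pint_fifth_multiple[OF assms] unfolding w_def by (intro pint_minus pint_mult) simp_all
    show "- (8/5 * P^4 * (a^2 - 11 * a * b - b^2)) = 40 * P^4 + P^6 * (- (8 * (P / 5 * w)))"
      unfolding quadratic by (simp add: field_simps eval_nat_numeral)
  qed
  have "(\<Sum>n<p. (25 * (2 * of_nat n + 1)^3 + 3 * (2 * of_nat n + 1)) * (-1)^n * (of_nat (apery' n))^2)
    = - 4 * P^2 * (a * b) + - (8/5 * P^4 * (a^2 - 11 * a * b - b^2))"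
    using sum_apery'_squares_closed_form[of p] assms \<open>odd p\<close> by (simp add: a_def b_def)
  also have "pcong 6 \<dots> (- 12 * P^2 - 40/3 * P^5 * B + 40 * P^4)"
    by (rule pcong_add[OF main small])
  also have "- 12 * P^2 - 40/3 * P^5 * B + 40 * P^4 = - 12 * P^2 + 40 * P^4 - 40/3 * P^5 * B"
    by simp
  finally show ?thesis unfolding B_def .
qed

end

theorem theorem4p5:
  fixes p :: nat
  assumes "prime p" and "p > 3"
  shows "rat_cong
    (\<Sum>n=0..p-1. (25 * (2 * of_nat n + 1)^3 + 3 * (2 * of_nat n + 1)) * (-1)^n * (of_nat (apery' n))^2)
    (- 12 * of_nat p ^ 2 + 40 * of_nat p ^ 4 - 40 / 3 * of_nat p ^ 5 * bernoulli (p - 3))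
    p 6"
proof -
  interpret p_adic p by unfold_locales (rule assms)
  let ?R = "- 12 * P ^ 2 + 40 * P ^ 4 - 40 / 3 * P ^ 5 * bernoulli (p - 3)"
  have "{0..p - 1} = {..<p}" using assms by auto
  then have sum: "pcong 6
    (\<Sum>n=0..p-1. (25 * (2 * of_nat n + 1)^3 + 3 * (2 * of_nat n + 1)) * (-1)^n * (of_nat (apery' n))^2) ?R"
    using squared_apery'_sum_pcong[OF assms(2)] by simp
  have "pint (- (12 * P ^ 2) + 40 * P ^ 4 - 40 * (1 / 3) * P ^ 5 * bernoulli (p - 3))"
    using assms pint_inverse[of 3] pint_bernoulli[of "p - 3"]
    by (intro pint_diff pint_add pint_mult pint_minus pint_power) simp_all
  then have R: "pint ?R" by simp
  show ?thesis
    unfolding rat_cong_def using pcong_pint[OF sum R] R sum[unfolded pcong_def] by blast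
qed

end
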